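(* Let $Z=z_1e_1+z_2e_2$, $\mathcal{V}=\nu_1e_1+\nu_2e_2=\alpha+j\beta$ ($\alpha,\beta\in\mathbb{C}(i)$), $C=c_1e_1+c_2e_2\in\mathbb{BC}$. Then the bicomplex Miller-Ross function satisfies: (i) $E_{\mathcal{V},C}(Z)=C^{-\mathcal{V}}E_{0,C}(Z)$ whenever $\alpha=-\frac{l_1+l_2}{2}$ and $\beta=\frac{l_1-l_2}{2i}$ with $l_1,l_2\in\mathbb{N}\cup\{0\}$; (ii) $Z^3E_{\mathcal{V},C}(Z)=CZ^3E_{\mathcal{V}+1,C}(Z)+(\mathcal{V}+1)(\mathcal{V}+2)(\mathcal{V}+3)\left[E_{\mathcal{V}+3,C}(Z)-CE_{\mathcal{V}+4,C}(Z)\right]$; (iii) $Z^2E_{\mathcal{V},C}(Z)=\frac{Z^{\mathcal{V}+2}}{\Gamma(\mathcal{V}+1)}+C^2Z^2E_{\mathcal{V}+2,C}(Z)+C(\mathcal{V}+2)(\mathcal{V}+3)\left[E_{\mathcal{V}+3,C}(Z)-CE_{\mathcal{V}+4,C}(Z)\right]$; (iv) $Z^2E_{\mathcal{V},C}(Z)=\frac{Z^{\mathcal{V}+2}}{\Gamma(\mathcal{V}+1)}+\frac{CZ^{\mathcal{V}+3}}{\Gamma(\mathcal{V}+2)}+C^3Z^2E_{\mathcal{V}+3,C}(Z)+C^2(\mathcal{V}+3)(\mathcal{V}+4)\left[E_{\mathcal{V}+4,C}(Z)-CE_{\mathcal{V}+5,C}(Z)\right]$.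
   Context: Bicomplex numbers: $\mathbb{BC}=\{w_1+jw_2: w_1,w_2\in\mathbb{C}(i)\}$, where $\mathbb{C}(i)$ is the complex field with unit $i$, $i^2=j^2=-1$, $ij=ji$. Put $e_1=\frac{1+ij}{2}$, $e_2=\frac{1-ij}{2}$, so $e_1+e_2=1$, $e_l^2=e_l$, $e_1e_2=0$. Every $Z=w_1+jw_2$ is uniquely $Z=z_1e_1+z_2e_2$ with $z_1=w_1-iw_2$, $z_2=w_1+iw_2\in\mathbb{C}(i)$, and addition, multiplication and division are componentwise in $e_1,e_2$; in particular $\nu_1=\alpha-i\beta$, $\nu_2=\alpha+i\beta$. Functions act componentwise: $\Gamma(Y)=\Gamma(y_1)e_1+\Gamma(y_2)e_2$ for $Y=y_1e_1+y_2e_2$ (with $1/\Gamma$ equal to $0$ at the poles of $\Gamma$), and $Z^{W}=z_1^{w_1}e_1+z_2^{w_2}e_2$ for $Z=z_1e_1+z_2e_2$, $W=w_1e_1+w_2e_2$ (principal complex powers; usual powers with $0^0=1$ for integer exponents). Identities are understood for $Z$ at which the occurring powers are defined (e.g. $z_1z_2\neq0$). Bicomplex Miller-Ross function: $E_{\mathcal{V},C}(Z)=Z^{\mathcal{V}}\sum_{r=0}^{\infty}\frac{(CZ)^r}{\Gamma(\mathcal{V}+r+1)}$ for $\mathcal{V},C,Z\in\mathbb{BC}$. *)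

theory Defs
  imports "HOL-Analysis.Analysis"
begin

section \<open>The ring of bicomplex numbers\<close>

text \<open>The term \<open>Bicomplex w1 w2\<close> stands for \<open>w1 + j w2\<close>, where \<open>w1\<close>, \<open>w2\<close> range over the
  complex field with imaginary unit \<open>\<i>\<close>.\<close>

datatype bicomplex = Bicomplex (bc_fst: complex) (bc_snd: complex)

lemma bicomplex_eq_iff: "X = Y \<longleftrightarrow> bc_fst X = bc_fst Y \<and> bc_snd X = bc_snd Y"
  by (cases X; cases Y) simp

instantiation bicomplex :: comm_ring_1
begin

definition "0 = Bicomplex 0 0"
definition "1 = Bicomplex 1 0"
definition "X + Y = Bicomplex (bc_fst X + bc_fst Y) (bc_snd X + bc_snd Y)"
definition "- X = Bicomplex (- bc_fst X) (- bc_snd X)"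
definition "X - Y = Bicomplex (bc_fst X - bc_fst Y) (bc_snd X - bc_snd Y)"
definition "X * Y = Bicomplex (bc_fst X * bc_fst Y - bc_snd X * bc_snd Y)
                              (bc_fst X * bc_snd Y + bc_snd X * bc_fst Y)"

instance
  by standard
    (simp_all add: bicomplex_eq_iff zero_bicomplex_def one_bicomplex_def plus_bicomplex_def
      uminus_bicomplex_def minus_bicomplex_def times_bicomplex_def algebra_simps)

end

lemma bc_fst_simps [simp]:
  "bc_fst 0 = 0" "bc_fst 1 = 1" "bc_fst (X + Y) = bc_fst X + bc_fst Y"
  "bc_fst (- X) = - bc_fst X" "bc_fst (X - Y) = bc_fst X - bc_fst Y"
  "bc_fst (X * Y) = bc_fst X * bc_fst Y - bc_snd X * bc_snd Y"
  by (simp_all add: zero_bicomplex_def one_bicomplex_def plus_bicomplex_def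
      uminus_bicomplex_def minus_bicomplex_def times_bicomplex_def)

lemma bc_snd_simps [simp]:
  "bc_snd 0 = 0" "bc_snd 1 = 0" "bc_snd (X + Y) = bc_snd X + bc_snd Y"
  "bc_snd (- X) = - bc_snd X" "bc_snd (X - Y) = bc_snd X - bc_snd Y"
  "bc_snd (X * Y) = bc_fst X * bc_snd Y + bc_snd X * bc_fst Y"
  by (simp_all add: zero_bicomplex_def one_bicomplex_def plus_bicomplex_def
      uminus_bicomplex_def minus_bicomplex_def times_bicomplex_def)

lemma bc_of_nat_simps [simp]:
  "bc_fst (of_nat n) = of_nat n" "bc_snd (of_nat n) = 0"
  by (induction n) simp_all

lemma bc_numeral_simps [simp]:
  "bc_fst (numeral n) = numeral n" "bc_snd (numeral n) = 0"
  using bc_of_nat_simps[of "numeral n"] by simp_all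

instantiation bicomplex :: real_vector
begin

definition "r *\<^sub>R X = Bicomplex (r *\<^sub>R bc_fst X) (r *\<^sub>R bc_snd X)"

instance
  by standard
    (simp_all add: bicomplex_eq_iff scaleR_bicomplex_def algebra_simps)

end

text \<open>The Euclidean norm \<open>sqrt (|w1|^2 + |w2|^2)\<close>, taken from the product space, gives
  infinite series of bicomplex numbers their meaning.\<close>

instantiation bicomplex :: real_normed_vector
begin

definition "norm X = norm (bc_fst X, bc_snd X)"
definition "sgn (X::bicomplex) = X /\<^sub>R norm X"
definition "dist X Y = norm (X - Y :: bicomplex)"
definition "(uniformity :: (bicomplex \<times> bicomplex) filter) =
  (INF e\<in>{0<..}. principal {(X, Y). dist X Y < e})"
definition "open (U :: bicomplex set) =
  (\<forall>X\<in>U. eventually (\<lambda>(X', Y). X' = X \<longrightarrow> Y \<in> U) uniformity)"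

instance
proof
  fix a :: real and X Y :: bicomplex and U :: "bicomplex set"
  show "(norm X = 0) = (X = 0)"
    by (simp add: norm_bicomplex_def bicomplex_eq_iff zero_prod_def)
  show "norm (X + Y) \<le> norm X + norm Y"
    using norm_triangle_ineq[of "(bc_fst X, bc_snd X)" "(bc_fst Y, bc_snd Y)"]
    by (simp add: norm_bicomplex_def)
  show "norm (a *\<^sub>R X) = \<bar>a\<bar> * norm X"
    using norm_scaleR[of a "(bc_fst X, bc_snd X)"]
    by (simp add: norm_bicomplex_def scaleR_bicomplex_def)
  show "dist X Y = norm (X - Y)" by (fact dist_bicomplex_def)
  show "sgn X = X /\<^sub>R norm X" by (fact sgn_bicomplex_def)
  show "(uniformity :: (bicomplex \<times> bicomplex) filter) =
      (INF e\<in>{0<..}. principal {(X, Y). dist X Y < e})"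
    by (fact uniformity_bicomplex_def)
  show "open U = (\<forall>X\<in>U. eventually (\<lambda>(X', Y). X' = X \<longrightarrow> Y \<in> U) uniformity)"
    by (fact open_bicomplex_def)
qed

end

section \<open>Idempotent representation\<close>

definition bc_of :: "complex \<Rightarrow> bicomplex" where
  "bc_of w = Bicomplex w 0"

definition bc_j :: bicomplex where
  "bc_j = Bicomplex 0 1"

definition bc_e1 :: bicomplex where
  "bc_e1 = bc_of (1 / 2) * (1 + bc_of \<i> * bc_j)"

definition bc_e2 :: bicomplex where
  "bc_e2 = bc_of (1 / 2) * (1 - bc_of \<i> * bc_j)"

definition bc_idem :: "complex \<Rightarrow> complex \<Rightarrow> bicomplex" where
  "bc_idem z1 z2 = bc_of z1 * bc_e1 + bc_of z2 * bc_e2"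

definition bc_pr1 :: "bicomplex \<Rightarrow> complex" where
  "bc_pr1 Z = bc_fst Z - \<i> * bc_snd Z"

definition bc_pr2 :: "bicomplex \<Rightarrow> complex" where
  "bc_pr2 Z = bc_fst Z + \<i> * bc_snd Z"

lemmas bc_basic_defs = bc_of_def bc_j_def bc_e1_def bc_e2_def bc_idem_def bc_pr1_def bc_pr2_def

lemma bicomplex_decompose: "Z = bc_of (bc_fst Z) + bc_j * bc_of (bc_snd Z)"
  by (simp add: bicomplex_eq_iff bc_basic_defs)

lemma bc_j_square: "bc_j * bc_j = -1" and bc_i_square: "bc_of \<i> * bc_of \<i> = -1"
  by (simp_all add: bicomplex_eq_iff bc_basic_defs)

lemma bc_e_idempotent:
  "bc_e1 + bc_e2 = 1" "bc_e1 * bc_e1 = bc_e1" "bc_e2 * bc_e2 = bc_e2" "bc_e1 * bc_e2 = 0"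
  by (simp_all add: bicomplex_eq_iff bc_basic_defs algebra_simps)

lemma bc_pr_idem [simp]: "bc_pr1 (bc_idem z1 z2) = z1" "bc_pr2 (bc_idem z1 z2) = z2"
  by (simp_all add: bc_basic_defs algebra_simps)

lemma bc_idem_pr [simp]: "bc_idem (bc_pr1 Z) (bc_pr2 Z) = Z"
  by (simp add: bicomplex_eq_iff bc_basic_defs algebra_simps)

lemma bicomplex_eq_pr_iff: "X = Y \<longleftrightarrow> bc_pr1 X = bc_pr1 Y \<and> bc_pr2 X = bc_pr2 Y"
  by (metis bc_idem_pr)

lemma bc_pr_mult [simp]:
  "bc_pr1 (X * Y) = bc_pr1 X * bc_pr1 Y" "bc_pr2 (X * Y) = bc_pr2 X * bc_pr2 Y"
  by (simp_all add: bc_basic_defs algebra_simps)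

section \<open>Componentwise functions and the Miller-Ross function\<close>

text \<open>The reciprocal of the Gamma function, equal to \<open>0\<close> in a component in which Gamma has a
  pole; division by \<open>\<Gamma>(Y)\<close> is multiplication by \<open>bc_rGamma Y\<close>.\<close>

definition bc_rGamma :: "bicomplex \<Rightarrow> bicomplex" where
  "bc_rGamma Y = bc_idem (rGamma (bc_pr1 Y)) (rGamma (bc_pr2 Y))"

text \<open>The principal power \<open>powr\<close> has \<open>0 powr 0 = 0\<close>; for integer exponents the usual power,
  with \<open>0\<close> to the power \<open>0\<close> equal to \<open>1\<close>, is used instead. Away from the base \<open>0\<close> the two agree.
  The power is meaningful if \<open>z \<noteq> 0\<close> or \<open>w \<in> \<nat>\<close>.\<close>

definition cpower :: "complex \<Rightarrow> complex \<Rightarrow> complex" where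
  "cpower z w = (if w \<in> \<int> then z powi \<lfloor>Re w\<rfloor> else z powr w)"

definition bc_power :: "bicomplex \<Rightarrow> bicomplex \<Rightarrow> bicomplex" where
  "bc_power Z W = bc_idem (cpower (bc_pr1 Z) (bc_pr1 W)) (cpower (bc_pr2 Z) (bc_pr2 W))"

definition miller_ross :: "bicomplex \<Rightarrow> bicomplex \<Rightarrow> bicomplex \<Rightarrow> bicomplex" where
  "miller_ross V C Z = bc_power Z V * (\<Sum>r. (C * Z) ^ r * bc_rGamma (V + of_nat r + 1))"

end

theory Submission
  imports Defs
begin

text \<open>Everything is componentwise, so it suffices to argue over the complex numbers. Splitting off
  the first term of the series gives \<open>E(v) = z^v / \<Gamma>(v + 1) + c E(v + 1)\<close>, where \<open>E(v)\<close> is the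
  Miller-Ross function of order \<open>v\<close>. Iterating this and using \<open>1 / \<Gamma>(v) = v / \<Gamma>(v + 1)\<close> yields
  (ii)-(iv). For \<open>v = -l\<close> the first \<open>l\<close> coefficients \<open>1 / \<Gamma>(r + 1 - l)\<close> vanish, so the
  recurrence loses its inhomogeneous term and gives \<open>E(-l) = c^l E(0)\<close>.\<close>

section \<open>Idempotent components\<close>

lemma bc_pr_simps [simp]:
  "bc_pr1 0 = 0" "bc_pr2 0 = 0" "bc_pr1 1 = 1" "bc_pr2 1 = 1"
  "bc_pr1 (X + Y) = bc_pr1 X + bc_pr1 Y" "bc_pr2 (X + Y) = bc_pr2 X + bc_pr2 Y"
  "bc_pr1 (X - Y) = bc_pr1 X - bc_pr1 Y" "bc_pr2 (X - Y) = bc_pr2 X - bc_pr2 Y"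
  "bc_pr1 (- X) = - bc_pr1 X" "bc_pr2 (- X) = - bc_pr2 X"
  "bc_pr1 (of_nat n) = of_nat n" "bc_pr2 (of_nat n) = of_nat n"
  "bc_pr1 (numeral k) = numeral k" "bc_pr2 (numeral k) = numeral k"
  by (simp_all add: bc_pr1_def bc_pr2_def algebra_simps)

lemma bc_pr_power [simp]: "bc_pr1 (X ^ n) = bc_pr1 X ^ n" "bc_pr2 (X ^ n) = bc_pr2 X ^ n"
  by (induction n) simp_all

lemma bc_pr_rGamma [simp]:
  "bc_pr1 (bc_rGamma Y) = rGamma (bc_pr1 Y)" "bc_pr2 (bc_rGamma Y) = rGamma (bc_pr2 Y)"
  by (simp_all add: bc_rGamma_def)

lemma bc_pr_bc_power [simp]:
  "bc_pr1 (bc_power Z W) = cpower (bc_pr1 Z) (bc_pr1 W)"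
  "bc_pr2 (bc_power Z W) = cpower (bc_pr2 Z) (bc_pr2 W)"
  by (simp_all add: bc_power_def)

lemma bc_pr_cartesian:
  "bc_pr1 (bc_of \<alpha> + bc_j * bc_of \<beta>) = \<alpha> - \<i> * \<beta>"
  "bc_pr2 (bc_of \<alpha> + bc_j * bc_of \<beta>) = \<alpha> + \<i> * \<beta>"
  by (simp_all add: bc_basic_defs)

lemma norm_bicomplex_le: "norm X \<le> norm (bc_fst X) + norm (bc_snd X)"
  unfolding norm_bicomplex_def by (rule norm_Pair_le)

text \<open>The Cartesian components are \<open>x / 2\<close> and \<open>\<i> * x / 2\<close>, whose
  norms add up to \<open>norm x\<close>. Boundedness lets the embedding commute with infinite
  sums.\<close>

lemma bounded_linear_bc_idem_left: "bounded_linear (\<lambda>x. bc_idem x 0)"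
proof (rule bounded_linear_intro[where K = 1])
  show "norm (bc_idem x 0) \<le> norm x * 1" for x
    using norm_bicomplex_le[of "bc_idem x 0"] by (simp add: bc_basic_defs norm_mult)
qed (simp_all add: bicomplex_eq_iff bc_basic_defs scaleR_bicomplex_def field_simps)

lemma bounded_linear_bc_idem_right: "bounded_linear (\<lambda>x. bc_idem 0 x)"
proof (rule bounded_linear_intro[where K = 1])
  show "norm (bc_idem 0 x) \<le> norm x * 1" for x
    using norm_bicomplex_le[of "bc_idem 0 x"] by (simp add: bc_basic_defs norm_mult)
qed (simp_all add: bicomplex_eq_iff bc_basic_defs scaleR_bicomplex_def field_simps)

lemma sums_bc_idem:
  assumes "(\<lambda>n. bc_pr1 (f n)) sums a" and "(\<lambda>n. bc_pr2 (f n)) sums b"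
  shows "f sums bc_idem a b"
proof -
  have split: "bc_idem x 0 + bc_idem 0 y = bc_idem x y" for x y
    by (simp add: bicomplex_eq_pr_iff)
  have "(\<lambda>n. bc_idem (bc_pr1 (f n)) 0 + bc_idem 0 (bc_pr2 (f n))) sums
      (bc_idem a 0 + bc_idem 0 b)"
    using assms
    by (intro sums_add bounded_linear.sums[OF bounded_linear_bc_idem_left]
        bounded_linear.sums[OF bounded_linear_bc_idem_right])
  then show ?thesis
    by (simp only: split bc_idem_pr)
qed

section \<open>The complex Miller-Ross function\<close>

text \<open>Since \<open>rGamma u = u * rGamma (u + 1)\<close>, passing from term \<open>n\<close>
  to the next costs a factor \<open>w / (v + n + 1)\<close>, which tends to 0.\<close>

lemma summable_rGamma_series:
  fixes w v :: complex
  shows "summable (\<lambda>r. w ^ r * rGamma (v + of_nat r + 1))"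
proof -
  \<comment> \<open>For \<open>n \<ge> N\<close> the reverse triangle inequality gives
    \<open>norm (v + n + 1) \<ge> 2 * norm w\<close>, hence ratio at most 1/2.\<close>
  obtain N :: nat where N: "2 * norm w + norm (v + 1) + 1 \<le> real N"
    using real_arch_simple by blast
  show ?thesis
  proof (rule summable_ratio_test[where c = "1/2" and N = N])
    fix n assume "N \<le> n"
    let ?u = "v + of_nat n + 1"
    have "norm (of_nat n :: complex) \<le> norm ?u + norm (v + 1)"
      using norm_triangle_ineq4[of ?u "v + 1"] by (simp add: algebra_simps)
    with N \<open>N \<le> n\<close> have u: "2 * norm w \<le> norm ?u"
      by simp
    have "norm (w ^ Suc n * rGamma (v + of_nat (Suc n) + 1))
        = norm w * (norm w ^ n * norm (rGamma (?u + 1)))"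
      by (simp add: norm_mult norm_power algebra_simps)
    also have "\<dots> \<le> (1/2 * norm ?u) * (norm w ^ n * norm (rGamma (?u + 1)))"
      using u by (intro mult_right_mono) auto
    also have "\<dots> = 1/2 * norm (w ^ n * rGamma ?u)"
      by (simp only: flip: rGamma_plus1[of ?u]) (simp add: norm_mult norm_power)
    finally show "norm (w ^ Suc n * rGamma (v + of_nat (Suc n) + 1))
        \<le> 1/2 * norm (w ^ n * rGamma ?u)" .
  qed simp
qed

definition cmiller_ross :: "complex \<Rightarrow> complex \<Rightarrow> complex \<Rightarrow> complex" where
  "cmiller_ross v c z = cpower z v * (\<Sum>r. (c * z) ^ r * rGamma (v + of_nat r + 1))"

text \<open>The reduction to scalars: both component series converge, so the bicomplex series has
  the sum assembled from theirs.\<close>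

lemma bc_pr_miller_ross [simp]:
  "bc_pr1 (miller_ross V C Z) = cmiller_ross (bc_pr1 V) (bc_pr1 C) (bc_pr1 Z)"
  "bc_pr2 (miller_ross V C Z) = cmiller_ross (bc_pr2 V) (bc_pr2 C) (bc_pr2 Z)"
proof -
  let ?S = "\<lambda>v c z :: complex. \<Sum>r. (c * z) ^ r * rGamma (v + of_nat r + 1)"
  have "(\<lambda>r. (C * Z) ^ r * bc_rGamma (V + of_nat r + 1)) sums
      bc_idem (?S (bc_pr1 V) (bc_pr1 C) (bc_pr1 Z)) (?S (bc_pr2 V) (bc_pr2 C) (bc_pr2 Z))"
    by (rule sums_bc_idem) (simp_all add: summable_rGamma_series summable_sums)
  then show "bc_pr1 (miller_ross V C Z) = cmiller_ross (bc_pr1 V) (bc_pr1 C) (bc_pr1 Z)"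
    and "bc_pr2 (miller_ross V C Z) = cmiller_ross (bc_pr2 V) (bc_pr2 C) (bc_pr2 Z)"
    by (simp_all add: miller_ross_def cmiller_ross_def sums_iff)
qed

section \<open>Powers under shifts of the exponent\<close>

lemma cpower_of_int: "cpower z (of_int k) = z powi k"
  by (simp add: cpower_def)

text \<open>Adding 1 preserves integrality, so both sides use the same branch of
  \<open>cpower\<close>. The hypothesis excludes \<open>z = 0\<close>, \<open>v = -1\<close>, where
  the left side is 1 and the right side 0.\<close>

lemma cpower_add_1:
  assumes "z \<noteq> 0 \<or> v \<in> \<nat>"
  shows "cpower z (v + 1) = z * cpower z v"
proof (cases "v \<in> \<int>")
  case True
  then obtain k where k: "v = of_int k"
    by (auto elim: Ints_cases)
  have "z \<noteq> 0 \<or> k \<ge> 0"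
    using assms k by (auto simp: Nats_altdef1)
  then have "z powi (k + 1) = z * z powi k"
    by (auto simp: power_int_add_1' power_int_0_left_if)
  then show ?thesis
    using cpower_of_int[of z k] cpower_of_int[of z "k + 1"] k by simp
next
  case False
  then have "v + 1 \<notin> \<int>"
    using Ints_diff[of "v + 1" 1] by auto
  moreover have "z \<noteq> 0"
    using assms False by (auto simp: Nats_altdef1)
  ultimately show ?thesis
    using False by (simp add: cpower_def powr_add)
qed

lemma cpower_add_of_nat:
  assumes "z \<noteq> 0 \<or> v \<in> \<nat>"
  shows "cpower z (v + of_nat n) = z ^ n * cpower z v"
proof (induction n)
  case (Suc n)
  have "z \<noteq> 0 \<or> v + of_nat n \<in> \<nat>"
    using assms by auto
  from cpower_add_1[OF this] Suc show ?case
    by (simp add: ac_simps)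
qed simp

lemma cpower_add_numeral:
  assumes "z \<noteq> 0 \<or> v \<in> \<nat>"
  shows "cpower z (v + numeral k) = z ^ numeral k * cpower z v"
  using cpower_add_of_nat[OF assms, of "numeral k"] by simp

section \<open>Recurrence in the order and its consequences\<close>

lemma cmiller_ross_rec:
  assumes "z \<noteq> 0 \<or> v \<in> \<nat>"
  shows "cmiller_ross v c z = cpower z v * rGamma (v + 1) + c * cmiller_ross (v + 1) c z"
proof -
  let ?a = "\<lambda>r. (c * z) ^ r * rGamma (v + of_nat r + 1)"
  let ?b = "\<lambda>r. (c * z) ^ r * rGamma (v + 1 + of_nat r + 1)"
  have "suminf ?a = rGamma (v + 1) + (\<Sum>r. ?a (Suc r))"
    using suminf_split_head[OF summable_rGamma_series[of "c * z" v]] by simp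
  \<comment> \<open>The index shift raises the order by 1; the extracted \<open>z\<close> later
    turns \<open>z^v\<close> into \<open>z^(v+1)\<close>.\<close>
  also have "(\<Sum>r. ?a (Suc r)) = (\<Sum>r. (c * z) * ?b r)"
    by (simp add: ac_simps)
  also have "\<dots> = c * z * suminf ?b"
    by (rule suminf_mult[OF summable_rGamma_series])
  finally show ?thesis
    unfolding cmiller_ross_def cpower_add_1[OF assms] by algebra
qed

lemma cmiller_ross_rec_numeral:
  assumes "z \<noteq> 0 \<or> v \<in> \<nat>"
  shows "cmiller_ross (v + numeral k) c z =
    z ^ numeral k * cpower z v * rGamma (v + (numeral k + 1)) +
    c * cmiller_ross (v + (numeral k + 1)) c z"
proof -
  have "z \<noteq> 0 \<or> v + numeral k \<in> \<nat>"
    using assms by auto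
  from cmiller_ross_rec[OF this, of c] show ?thesis
    by (simp add: cpower_add_numeral[OF assms] add.assoc)
qed

lemma cmiller_ross_neg_nat:
  assumes "z \<noteq> 0 \<or> l = 0"
  shows "cmiller_ross (- of_nat l) c z = c ^ l * cmiller_ross 0 c z"
  using assms
proof (induction l)
  case (Suc l)
  then have "z \<noteq> 0"
    by simp
  \<comment> \<open>At order \<open>-(l + 1)\<close> the inhomogeneous term contains
    \<open>rGamma\<close> at \<open>-l\<close>, a pole of Gamma.\<close>
  moreover have "rGamma (- of_nat l :: complex) = 0"
    by (simp add: rGamma_eq_zero_iff)
  ultimately show ?case
    using Suc.IH cmiller_ross_rec[of z "- of_nat (Suc l)" c] by simp
qed simp

lemma rGamma_rec_numeral:
  "rGamma (v + numeral k :: complex) = (v + numeral k) * rGamma (v + (numeral k + 1))"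
  using rGamma_plus1[of "v + numeral k"] by (simp add: add.assoc)

text \<open>Each bracket is a single term in disguise:
  \<open>E(v+3) - c E(v+4) = z^(v+3) / \<Gamma>(v+4)\<close>, and likewise one order higher. The
  polynomial factors lower the Gamma argument, leaving the recurrence applied once, twice and three
  times.\<close>

lemma cmiller_ross_identities:
  assumes "z \<noteq> 0 \<or> v \<in> \<nat>"
  shows
    "z ^ 3 * cmiller_ross v c z =
       c * z ^ 3 * cmiller_ross (v + 1) c z +
       (v + 1) * (v + 2) * (v + 3) * (cmiller_ross (v + 3) c z - c * cmiller_ross (v + 4) c z)"
      (is ?ii)
    "z ^ 2 * cmiller_ross v c z =
       cpower z (v + 2) * rGamma (v + 1) + c ^ 2 * z ^ 2 * cmiller_ross (v + 2) c z +
       c * (v + 2) * (v + 3) * (cmiller_ross (v + 3) c z - c * cmiller_ross (v + 4) c z)"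
      (is ?iii)
    "z ^ 2 * cmiller_ross v c z =
       cpower z (v + 2) * rGamma (v + 1) + c * cpower z (v + 3) * rGamma (v + 2) +
       c ^ 3 * z ^ 2 * cmiller_ross (v + 3) c z +
       c ^ 2 * (v + 3) * (v + 4) * (cmiller_ross (v + 4) c z - c * cmiller_ross (v + 5) c z)"
      (is ?iv)
proof -
  let ?p = "cpower z v" and ?E = "\<lambda>w. cmiller_ross w c z"
  \<comment> \<open>The literal \<open>1\<close> is not a \<open>numeral\<close> term, so order
    \<open>v + 1\<close> is treated separately.\<close>
  have "z \<noteq> 0 \<or> v + 1 \<in> \<nat>"
    using assms by auto
  from cmiller_ross_rec[OF this, of c]
  have E1: "?E (v + 1) = z * ?p * rGamma (v + 2) + c * ?E (v + 2)"
    by (simp add: cpower_add_1[OF assms] add.assoc)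
  note E0 = cmiller_ross_rec[OF assms, of c]
  note E = cmiller_ross_rec_numeral[OF assms, of _ c]
  have E2: "?E (v + 2) = z ^ 2 * ?p * rGamma (v + 3) + c * ?E (v + 3)"
    and E3: "?E (v + 3) = z ^ 3 * ?p * rGamma (v + 4) + c * ?E (v + 4)"
    and E4: "?E (v + 4) = z ^ 4 * ?p * rGamma (v + 5) + c * ?E (v + 5)"
    using E[of "num.Bit0 num.One"] E[of "num.Bit1 num.One"] E[of "num.Bit0 (num.Bit0 num.One)"]
    by simp_all
  have R1: "rGamma (v + 1) = (v + 1) * rGamma (v + 2)"
    using rGamma_plus1[of "v + 1"] by (simp add: add.assoc)
  have R2: "rGamma (v + 2) = (v + 2) * rGamma (v + 3)"
    and R3: "rGamma (v + 3) = (v + 3) * rGamma (v + 4)"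
    and R4: "rGamma (v + 4) = (v + 4) * rGamma (v + 5)"
    using rGamma_rec_numeral[of v "num.Bit0 num.One"] rGamma_rec_numeral[of v "num.Bit1 num.One"]
      rGamma_rec_numeral[of v "num.Bit0 (num.Bit0 num.One)"]
    by simp_all
  have "?E (v + 3) - c * ?E (v + 4) = z ^ 3 * ?p * rGamma (v + 4)"
    using E3 by simp
  then have D3: "(v + 2) * (v + 3) * (?E (v + 3) - c * ?E (v + 4)) = z ^ 3 * ?p * rGamma (v + 2)"
    by (simp add: R2 R3)
  have "?E (v + 4) - c * ?E (v + 5) = z ^ 4 * ?p * rGamma (v + 5)"
    using E4 by simp
  then have D4: "(v + 3) * (v + 4) * (?E (v + 4) - c * ?E (v + 5)) = z ^ 4 * ?p * rGamma (v + 3)"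
    by (simp add: R3 R4)
  \<comment> \<open>The products are bracketed so that \<open>D3\<close> applies; the remaining
    factor \<open>v + 1\<close> is absorbed by \<open>R1\<close>.\<close>
  have "c * z ^ 3 * ?E (v + 1) + (v + 1) * ((v + 2) * (v + 3) * (?E (v + 3) - c * ?E (v + 4)))
      = z ^ 3 * ?E v"
    unfolding D3 E0 R1 by (simp add: algebra_simps)
  then show ?ii
    by (simp only: mult.assoc)
  have "cpower z (v + 2) * rGamma (v + 1) + c ^ 2 * z ^ 2 * ?E (v + 2) +
      c * ((v + 2) * (v + 3) * (?E (v + 3) - c * ?E (v + 4))) = z ^ 2 * ?E v"
    unfolding D3 E0 E1 cpower_add_numeral[OF assms]
    by (simp add: algebra_simps power2_eq_square power3_eq_cube)
  then show ?iii
    by (simp only: mult.assoc)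
  have "cpower z (v + 2) * rGamma (v + 1) + c * cpower z (v + 3) * rGamma (v + 2) +
      c ^ 3 * z ^ 2 * ?E (v + 3) +
      c ^ 2 * ((v + 3) * (v + 4) * (?E (v + 4) - c * ?E (v + 5))) = z ^ 2 * ?E v"
    unfolding D4 E0 E1 E2 cpower_add_numeral[OF assms]
    by (simp add: algebra_simps power2_eq_square power3_eq_cube power4_eq_xxxx)
  then show ?iv
    by (simp only: mult.assoc)
qed

theorem theorem2p2:
  fixes Z V C :: bicomplex
    and z1 z2 \<nu>1 \<nu>2 c1 c2 \<alpha> \<beta> :: complex
  assumes "Z = bc_of z1 * bc_e1 + bc_of z2 * bc_e2"
    and "V = bc_of \<nu>1 * bc_e1 + bc_of \<nu>2 * bc_e2"
    and "V = bc_of \<alpha> + bc_j * bc_of \<beta>"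
    and "C = bc_of c1 * bc_e1 + bc_of c2 * bc_e2"
    and "z1 \<noteq> 0 \<or> \<nu>1 \<in> \<nat>"
    and "z2 \<noteq> 0 \<or> \<nu>2 \<in> \<nat>"
  shows
    "(\<forall>l1 l2 :: nat.
        \<alpha> = - (of_nat l1 + of_nat l2) / 2 \<and> \<beta> = (of_nat l1 - of_nat l2) / (2 * \<i>) \<longrightarrow>
        miller_ross V C Z = bc_power C (- V) * miller_ross 0 C Z) \<and>
     Z ^ 3 * miller_ross V C Z =
        C * Z ^ 3 * miller_ross (V + 1) C Z +
        (V + 1) * (V + 2) * (V + 3) * (miller_ross (V + 3) C Z - C * miller_ross (V + 4) C Z) \<and>
     Z ^ 2 * miller_ross V C Z =
        bc_power Z (V + 2) * bc_rGamma (V + 1) + C ^ 2 * Z ^ 2 * miller_ross (V + 2) C Z +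
        C * (V + 2) * (V + 3) * (miller_ross (V + 3) C Z - C * miller_ross (V + 4) C Z) \<and>
     Z ^ 2 * miller_ross V C Z =
        bc_power Z (V + 2) * bc_rGamma (V + 1) + C * bc_power Z (V + 3) * bc_rGamma (V + 2) +
        C ^ 3 * Z ^ 2 * miller_ross (V + 3) C Z +
        C ^ 2 * (V + 3) * (V + 4) * (miller_ross (V + 4) C Z - C * miller_ross (V + 5) C Z)"
proof -
  have V: "bc_pr1 V = \<nu>1" "bc_pr2 V = \<nu>2" and Z: "bc_pr1 Z = z1" "bc_pr2 Z = z2"
    using assms(1,2) by (simp_all flip: bc_idem_def)
  note nz1 = assms(5) and nz2 = assms(6)
  have "miller_ross V C Z = bc_power C (- V) * miller_ross 0 C Z"
    if \<alpha>: "\<alpha> = - (of_nat l1 + of_nat l2) / 2" and \<beta>: "\<beta> = (of_nat l1 - of_nat l2) / (2 * \<i>)"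
    for l1 l2 :: nat
  proof -
    \<comment> \<open>Here \<open>\<i> * \<beta> = (l1 - l2) / 2\<close>, so
      \<open>\<alpha> - \<i> * \<beta> = -l1\<close> and
      \<open>\<alpha> + \<i> * \<beta> = -l2\<close>.\<close>
    have \<nu>: "\<nu>1 = - of_nat l1" "\<nu>2 = - of_nat l2"
      using V bc_pr_cartesian[of \<alpha> \<beta>] unfolding assms(3) \<alpha> \<beta> by (simp_all add: field_simps)
    have nat_neg: "l = 0" if "- of_nat l \<in> (\<nat> :: complex set)" for l :: nat
      using that by (auto elim!: Nats_cases simp: neg_eq_iff_add_eq_0 simp flip: of_nat_add)
    have "z1 \<noteq> 0 \<or> l1 = 0" "z2 \<noteq> 0 \<or> l2 = 0"
      using nz1 nz2 nat_neg by (auto simp: \<nu>)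
    \<comment> \<open>The exponent \<open>-V\<close> has components \<open>l1\<close> and
      \<open>l2\<close>, so only ordinary powers of \<open>C\<close> occur, even when a component of
      \<open>C\<close> is 0.\<close>
    moreover have "cpower c (of_nat l) = c ^ l" for c l
      using cpower_of_int[of c "int l"] by simp
    ultimately show ?thesis
      by (simp add: bicomplex_eq_pr_iff V Z \<nu> cmiller_ross_neg_nat)
  qed
  then show ?thesis
    by (intro conjI allI impI)
      (use cmiller_ross_identities[OF nz1] cmiller_ross_identities[OF nz2] in
        \<open>auto simp only: bicomplex_eq_pr_iff bc_pr_mult bc_pr_simps bc_pr_power bc_pr_rGamma
          bc_pr_bc_power bc_pr_miller_ross V Z\<close>)
qed

end
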